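(* Let $t,p\ge 2$ be integers, let $C_p^{(t)}$ be the crown multipartite graph, let $d=(t-1)(p-1)$ and put $c=\phi(d,d)$, where $\phi$ is a symmetric real-valued degree weight. Then $$\operatorname{Spec}(\dot A(C_p^{(t)}))=\Big\{((t-1)(p-1)c)^{[1]},\,(-(t-1)c)^{[p-1]},\,(-(p-1)c)^{[t-1]},\,c^{[(t-1)(p-1)]}\Big\}.$$ Consequently, $\dot E_\phi(C_p^{(t)})=4(t-1)(p-1)|c|$; in particular, if $c>0$, then $\dot E_\phi(C_p^{(t)})=4(t-1)(p-1)c$. If $c\ne 0$, then $\dot A(C_p^{(t)})$ is nonsingular. Moreover, if $c>0$, its inertia is $$\operatorname{In}(\dot A(C_p^{(t)}))=\left(1+(t-1)(p-1),\,p+t-2,\,0\right),$$ and if $c<0$, then $$\operatorname{In}(\dot A(C_p^{(t)}))=\left(p+t-2,\,1+(t-1)(p-1),\,0\right).$$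
   Context: The crown multipartite graph $C_p^{(t)}$ has vertex set $\{u_{ik}:1\le i\le t,\ 1\le k\le p\}$, with $u_{ik}$ adjacent to $u_{j\ell}$ if and only if $i\ne j$ and $k\ne\ell$ (i.e. it is the complete $t$-partite graph with parts $V_i=\{u_{i1},\dots,u_{ip}\}$ from which all edges $u_{ik}u_{jk}$, $i\ne j$, are deleted). For a symmetric function $\phi:\mathbb R_{>0}\times\mathbb R_{>0}\to\mathbb R$ and a finite simple graph $G$ with vertices $v_1,\dots,v_n$ of degrees $d_1,\dots,d_n$, the degree-based weighted adjacency matrix $\dot A(G)$ is the $n\times n$ real symmetric matrix whose $(i,j)$ entry is $\phi(d_i,d_j)$ if $v_i$ and $v_j$ are adjacent, and $0$ otherwise. $\operatorname{Spec}(M)$ is the multiset of eigenvalues of $M$; $\lambda^{[k]}$ means $\lambda$ repeated with multiplicity $k$ (coinciding listed values have their multiplicities added). The energy $\dot E_\phi(G)$ is the sum of the absolute values of the eigenvalues of $\dot A(G)$. The inertia $\operatorname{In}(M)=(n_+,n_-,n_0)$ counts positive, negative and zero eigenvalues with multiplicity. *)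

theory Defs
  imports
    "Graph_Theory.Pair_Digraph"
    "Jordan_Normal_Form.Char_Poly"
begin

text \<open>Finite simple graphs are the loopfree symmetric finite digraphs of the locale
  \<^locale>\<open>pair_graph\<close>: an edge is a pair of opposite arcs, so the degree of a vertex is its
  out-degree. The matrix of a graph refers to an enumeration \<open>vs\<close> of its vertices.\<close>

definition vertex_enumeration :: "'a pair_pre_digraph \<Rightarrow> 'a list \<Rightarrow> bool" where
  "vertex_enumeration G vs \<longleftrightarrow> distinct vs \<and> set vs = pverts G"

definition weighted_adj_mat ::
    "(real \<Rightarrow> real \<Rightarrow> real) \<Rightarrow> 'a pair_pre_digraph \<Rightarrow> 'a list \<Rightarrow> real mat" where
  "weighted_adj_mat \<phi> G vs = mat (length vs) (length vs) (\<lambda>(i, j).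
     if (vs ! i, vs ! j) \<in> parcs G
     then \<phi> (real (out_degree (with_proj G) (vs ! i))) (real (out_degree (with_proj G) (vs ! j)))
     else 0)"

definition crown_multipartite :: "nat \<Rightarrow> nat \<Rightarrow> (nat \<times> nat) pair_pre_digraph" where
  "crown_multipartite t p =
     \<lparr> pverts = {1..t} \<times> {1..p},
       parcs = {((i, k), (j, l)) | i k j l.
         i \<in> {1..t} \<and> j \<in> {1..t} \<and> k \<in> {1..p} \<and> l \<in> {1..p} \<and> i \<noteq> j \<and> k \<noteq> l} \<rparr>"

lemma pair_graph_crown_multipartite: "pair_graph (crown_multipartite t p)"
proof
  have "parcs (crown_multipartite t p) \<subseteq> ({1..t} \<times> {1..p}) \<times> ({1..t} \<times> {1..p})"
    by (auto simp: crown_multipartite_def)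
  then show "finite (parcs (crown_multipartite t p))"
    by (rule finite_subset) simp
qed (auto simp: crown_multipartite_def symmetric_def intro!: symI)

text \<open>The eigenvalues with their multiplicities as roots of the characteristic polynomial. Only
  real roots are counted; for the symmetric matrices considered here these are all of them, and
  their algebraic and geometric multiplicities agree.\<close>

definition Spec :: "real mat \<Rightarrow> real multiset" where
  "Spec A = proots (char_poly A)"

definition energy :: "(real \<Rightarrow> real \<Rightarrow> real) \<Rightarrow> 'a pair_pre_digraph \<Rightarrow> 'a list \<Rightarrow> real" where
  "energy \<phi> G vs = (\<Sum>x\<in>#Spec (weighted_adj_mat \<phi> G vs). \<bar>x\<bar>)"

definition inertia :: "real mat \<Rightarrow> nat \<times> nat \<times> nat" where
  "inertia A = (size {#x \<in># Spec A. x > 0#}, size {#x \<in># Spec A. x < 0#},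
     size {#x \<in># Spec A. x = 0#})"

end

theory Submission
  imports Defs
begin

text \<open>The crown graph is regular of degree \<open>d = (t - 1) (p - 1)\<close>, so its weighted adjacency matrix is
  \<open>c\<close> times a 0-1 matrix. Two vertices are adjacent exactly when they differ in both coordinates, so
  this 0-1 matrix is the tensor product \<open>(J\<^sub>t - I) \<otimes> (J\<^sub>p - I)\<close> of the adjacency matrices of two complete
  graphs. The eigenvalues of \<open>J\<^sub>n - I\<close> are \<open>n - 1\<close>, once, and \<open>-1\<close>, with multiplicity \<open>n - 1\<close>; those of a
  tensor product are the products of the eigenvalues of the factors. This gives the four listed
  eigenvalues with multiplicities \<open>1\<close>, \<open>p - 1\<close>, \<open>t - 1\<close> and \<open>(t - 1) (p - 1)\<close>. Energy, nonsingularity and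
  inertia are then read off; each of the four groups contributes \<open>(t - 1) (p - 1) \<bar>c\<bar>\<close> to the energy.

  Since multiplicities here are those of roots of the characteristic polynomial, the argument goes
  through triangular forms rather than eigenvectors: \<open>complete_graph_triangularised\<close> brings each
  factor to upper triangular form by a base change over the integers, the tensor product of the two
  base changes makes the whole matrix upper triangular in lexicographic order
  (\<open>nth_lex_pairs_mono\<close>), and \<open>Spec_kernel_mat_triangularised\<close> reads the spectrum off the
  diagonal, whatever enumeration of the vertices the matrix was written in.\<close>

section \<open>Kernels on a finite set and their matrices\<close>

text \<open>The matrix of a kernel with respect to two enumerations. Conjugating by such matrices changes
  the order of the vertices and the basis in one step, so an arbitrary enumeration of the graph can
  be compared with the one that makes the kernel triangular.\<close>

definition kernel_mat :: "('a \<Rightarrow> 'b \<Rightarrow> real) \<Rightarrow> 'a list \<Rightarrow> 'b list \<Rightarrow> real mat" where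
  "kernel_mat K xs ys = mat (length xs) (length ys) (\<lambda>(i, j). K (xs ! i) (ys ! j))"

definition kernel_comp :: "'b set \<Rightarrow> ('a \<Rightarrow> 'b \<Rightarrow> real) \<Rightarrow> ('b \<Rightarrow> 'c \<Rightarrow> real) \<Rightarrow> 'a \<Rightarrow> 'c \<Rightarrow> real" where
  "kernel_comp V K L = (\<lambda>x z. \<Sum>y\<in>V. K x y * L y z)"

definition kernel_tensor ::
    "('a \<Rightarrow> 'b \<Rightarrow> real) \<Rightarrow> ('c \<Rightarrow> 'd \<Rightarrow> real) \<Rightarrow> 'a \<times> 'c \<Rightarrow> 'b \<times> 'd \<Rightarrow> real" where
  "kernel_tensor K L = (\<lambda>x y. K (fst x) (fst y) * L (snd x) (snd y))"

lemma kernel_mat_carrier [simp]: "kernel_mat K xs ys \<in> carrier_mat (length xs) (length ys)"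
  by (simp add: kernel_mat_def)

lemma kernel_mat_cong:
  assumes "\<And>x y. x \<in> set xs \<Longrightarrow> y \<in> set ys \<Longrightarrow> K x y = L x y"
  shows "kernel_mat K xs ys = kernel_mat L xs ys"
  unfolding kernel_mat_def by (rule cong_mat) (use assms in auto)

lemma kernel_mat_mult:
  assumes "distinct ys"
  shows "kernel_mat K xs ys * kernel_mat L ys zs = kernel_mat (kernel_comp (set ys) K L) xs zs"
proof (rule eq_matI)
  fix i j
  assume "i < dim_row (kernel_mat (kernel_comp (set ys) K L) xs zs)"
    and "j < dim_col (kernel_mat (kernel_comp (set ys) K L) xs zs)"
  then have ij: "i < length xs" "j < length zs"
    by (simp_all add: kernel_mat_def)
  have "(\<Sum>m = 0..<length ys. K (xs ! i) (ys ! m) * L (ys ! m) (zs ! j))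
      = (\<Sum>y\<in>set ys. K (xs ! i) y * L y (zs ! j))"
    by (rule sum.reindex_bij_betw[OF bij_betw_nth]) (use assms in \<open>auto simp: atLeast0LessThan\<close>)
  with ij show "(kernel_mat K xs ys * kernel_mat L ys zs) $$ (i, j)
      = kernel_mat (kernel_comp (set ys) K L) xs zs $$ (i, j)"
    by (simp add: kernel_mat_def kernel_comp_def scalar_prod_def)
qed (simp_all add: kernel_mat_def)

lemma kernel_mat_delta:
  assumes "distinct xs" and "\<And>x y. x \<in> set xs \<Longrightarrow> y \<in> set xs \<Longrightarrow> K x y = of_bool (x = y)"
  shows "kernel_mat K xs xs = 1\<^sub>m (length xs)"
  by (rule eq_matI) (use assms in \<open>auto simp: kernel_mat_def nth_eq_iff_index_eq\<close>)

text \<open>Tensor products compose factor by factor, because a sum over a product set of products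
  factorises.\<close>

lemma kernel_comp_tensor:
  "kernel_comp (V \<times> W) (kernel_tensor K L) (kernel_tensor K' L')
    = kernel_tensor (kernel_comp V K K') (kernel_comp W L L')"
  by (simp add: kernel_comp_def kernel_tensor_def fun_eq_iff sum_product sum.cartesian_product
      case_prod_unfold mult_ac)

section \<open>Spectra\<close>

lemma Spec_upper_triangular:
  assumes "A \<in> carrier_mat n n" and "upper_triangular A"
  shows "Spec A = mset (diag_mat A)"
proof -
  have "proots (\<Prod>a\<leftarrow>xs. [:- a, 1:]) = mset xs" for xs :: "real list"
  proof (induction xs)
    case (Cons a xs)
    have "(\<Prod>a\<leftarrow>xs. [:- a, 1:]) \<noteq> 0"
      by (auto simp: prod_list_zero_iff)
    with Cons show ?case
      by (simp add: proots_mult del: mult_pCons_left)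
  qed simp
  then show ?thesis
    by (simp add: Spec_def char_poly_upper_triangular[OF assms])
qed

lemma invertible_mat_if_zero_notin_Spec:
  assumes A: "A \<in> carrier_mat n n" and "0 \<notin># Spec A"
  shows "invertible_mat A"
proof -
  have "char_poly A \<noteq> 0"
    using degree_monic_char_poly[OF A] by auto
  with assms have "\<not> eigenvalue A 0"
    by (simp add: Spec_def eigenvalue_root_char_poly)
  moreover have "char_matrix A 0 = A"
    using A by (auto simp: char_matrix_def)
  ultimately have "det A \<noteq> 0"
    using eigenvalue_det[OF A] by simp
  then obtain B where "B \<in> carrier_mat n n" "B * A = 1\<^sub>m n" "A * B = 1\<^sub>m n"
    using det_non_zero_imp_unit[OF A, of "()"] by (auto simp: Units_def ring_mat_def)
  with A show ?thesis
    unfolding invertible_mat_def inverts_mat_def by auto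
qed

text \<open>If \<open>S\<close> and \<open>R\<close> are mutually inverse and \<open>K = S T R\<close> with \<open>T\<close> triangular along some
  enumeration \<open>us\<close>, then the matrix of \<open>K\<close> is similar to a triangular one whatever enumeration it
  is written in, so the spectrum is the diagonal of \<open>T\<close>.\<close>

lemma Spec_kernel_mat_triangularised:
  assumes vs: "distinct vs" "set vs = V" and us: "distinct us" "set us = V"
    and SR: "\<And>x y. x \<in> V \<Longrightarrow> y \<in> V \<Longrightarrow> kernel_comp V S R x y = of_bool (x = y)"
    and RS: "\<And>x y. x \<in> V \<Longrightarrow> y \<in> V \<Longrightarrow> kernel_comp V R S x y = of_bool (x = y)"
    and K: "\<And>x y. x \<in> V \<Longrightarrow> y \<in> V \<Longrightarrow> K x y = kernel_comp V S (kernel_comp V T R) x y"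
    and T: "\<And>i j. j < i \<Longrightarrow> i < length us \<Longrightarrow> T (us ! i) (us ! j) = 0"
  shows "Spec (kernel_mat K vs vs) = image_mset (\<lambda>x. T x x) (mset_set V)"
proof -
  let ?A = "kernel_mat K vs vs" and ?T = "kernel_mat T us us"
  let ?P = "kernel_mat S vs us" and ?Q = "kernel_mat R us vs"
  have len: "length us = length vs"
    using vs us by (metis distinct_card)
  have "?A = ?P * (?T * ?Q)"
    using vs us K by (auto simp: kernel_mat_mult intro!: kernel_mat_cong)
  also have "\<dots> = ?P * ?T * ?Q"
    by (rule assoc_mult_mat[symmetric]) (rule kernel_mat_carrier)+
  finally have "?A = ?P * ?T * ?Q" .
  moreover have "?P * ?Q = 1\<^sub>m (length vs)" "?Q * ?P = 1\<^sub>m (length vs)"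
    using kernel_mat_delta[OF vs(1), of "kernel_comp V S R"]
      kernel_mat_delta[OF us(1), of "kernel_comp V R S"] vs us SR RS
    by (simp_all add: kernel_mat_mult len)
  moreover have "{?A, ?T, ?P, ?Q} \<subseteq> carrier_mat (length vs) (length vs)"
    using kernel_mat_carrier len by (metis empty_subsetI insert_subset)
  ultimately have "similar_mat ?A ?T"
    by (intro similar_matI)
  then have "Spec ?A = Spec ?T"
    unfolding Spec_def by (simp add: char_poly_similar)
  also have "\<dots> = mset (diag_mat ?T)"
    by (rule Spec_upper_triangular[OF kernel_mat_carrier])
      (use T in \<open>auto simp: kernel_mat_def\<close>)
  also have "diag_mat ?T = map (\<lambda>i. T (us ! i) (us ! i)) [0..<length us]"
    by (auto simp: diag_mat_def kernel_mat_def)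
  also have "\<dots> = map (\<lambda>x. T x x) us"
    by (rule nth_equalityI) auto
  also have "mset \<dots> = image_mset (\<lambda>x. T x x) (mset_set V)"
    using us by (simp flip: mset_set_set)
  finally show ?thesis .
qed

section \<open>Triangularising the complete graph\<close>

text \<open>The adjacency matrix \<open>J - I\<close> of the complete graph on \<open>{1..n}\<close>, in the basis consisting of the
  all-ones vector \<open>f\<^sub>1\<close> and the unit vectors \<open>f\<^sub>j = e\<^sub>j\<close> for \<open>j \<ge> 2\<close>: since
  \<open>(J - I) f\<^sub>1 = (n - 1) f\<^sub>1\<close> and \<open>(J - I) f\<^sub>j = f\<^sub>1 - f\<^sub>j\<close>, it becomes upper triangular. The three
  kernels are the matrix with columns \<open>f\<^sub>j\<close>, its inverse, and the triangular form.\<close>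

definition ones_basis :: "nat \<Rightarrow> nat \<Rightarrow> real" where
  "ones_basis i j = of_bool (j = 1 \<or> i = j)"

definition ones_basis_inv :: "nat \<Rightarrow> nat \<Rightarrow> real" where
  "ones_basis_inv i j = (if i = j then 1 else if j = 1 then - 1 else 0)"

definition complete_triangular :: "nat \<Rightarrow> nat \<Rightarrow> nat \<Rightarrow> real" where
  "complete_triangular n i j =
     (if i = j then if i = 1 then real n - 1 else - 1 else of_bool (i = 1))"

lemma sum_split_first:
  fixes f :: "nat \<Rightarrow> real"
  assumes "i \<in> {1..n}"
  shows "(\<Sum>j\<in>{1..n}. f j) = f 1 + (\<Sum>j\<in>{2..n}. f j)"
  using assms by (simp add: sum.atLeast_Suc_atMost numeral_2_eq_2)

lemma kernel_comp_ones_basis: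
  assumes "i \<in> {1..n}"
  shows "kernel_comp {1..n} ones_basis L i l = L 1 l + (if i = 1 then 0 else L i l)"
proof -
  have "(\<Sum>j\<in>{2..n}. ones_basis i j * L j l) = (\<Sum>j\<in>{2..n}. if i = j then L j l else 0)"
    by (rule sum.cong) (auto simp: ones_basis_def)
  with assms show ?thesis
    unfolding kernel_comp_def sum_split_first[OF assms] by (auto simp: ones_basis_def)
qed

lemma kernel_comp_ones_basis_inv:
  assumes "i \<in> {1..n}"
  shows "kernel_comp {1..n} ones_basis_inv L i l = L i l - (if i = 1 then 0 else L 1 l)"
proof -
  have "(\<Sum>j\<in>{2..n}. ones_basis_inv i j * L j l) = (\<Sum>j\<in>{2..n}. if i = j then L j l else 0)"
    by (rule sum.cong) (auto simp: ones_basis_inv_def)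
  with assms show ?thesis
    unfolding kernel_comp_def sum_split_first[OF assms] by (auto simp: ones_basis_inv_def)
qed

lemma ones_basis_inverse:
  assumes "i \<in> {1..n}" and "l \<in> {1..n}"
  shows "kernel_comp {1..n} ones_basis ones_basis_inv i l = of_bool (i = l)"
    and "kernel_comp {1..n} ones_basis_inv ones_basis i l = of_bool (i = l)"
  unfolding kernel_comp_ones_basis[OF assms(1)] kernel_comp_ones_basis_inv[OF assms(1)]
  by (auto simp: ones_basis_def ones_basis_inv_def)

lemma kernel_comp_complete_triangular_inv:
  assumes i: "i \<in> {1..n}" and l: "l \<in> {1..n}"
  shows "kernel_comp {1..n} (complete_triangular n) ones_basis_inv i l
    = (if i = 1 then of_bool (l \<noteq> 1) else - ones_basis_inv i l)"
proof (cases "i = 1")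
  case True
  have "(\<Sum>j\<in>{2..n}. complete_triangular n 1 j * ones_basis_inv j l)
      = (\<Sum>j\<in>{2..n}. if l = 1 then - 1 else if l = j then 1 else 0)"
    by (rule sum.cong) (auto simp: complete_triangular_def ones_basis_inv_def)
  with True i l show ?thesis
    unfolding kernel_comp_def sum_split_first[OF i]
    by (auto simp: complete_triangular_def ones_basis_inv_def of_nat_diff)
next
  case False
  have "(\<Sum>j\<in>{2..n}. complete_triangular n i j * ones_basis_inv j l)
      = (\<Sum>j\<in>{2..n}. if i = j then - ones_basis_inv j l else 0)"
    by (rule sum.cong) (use False in \<open>auto simp: complete_triangular_def\<close>)
  with False i l show ?thesis
    unfolding kernel_comp_def sum_split_first[OF i]
    by (auto simp: complete_triangular_def)
qed

lemma complete_graph_triangularised: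
  assumes "i \<in> {1..n}" and "l \<in> {1..n}"
  shows "kernel_comp {1..n} ones_basis (kernel_comp {1..n} (complete_triangular n) ones_basis_inv) i l
    = of_bool (i \<noteq> l)"
proof -
  have "1 \<in> {1..n}"
    using assms by auto
  then show ?thesis
    unfolding kernel_comp_ones_basis[OF assms(1)]
      kernel_comp_complete_triangular_inv[OF assms]
      kernel_comp_complete_triangular_inv[OF \<open>1 \<in> {1..n}\<close> assms(2)]
    by (auto simp: ones_basis_inv_def)
qed

section \<open>The crown multipartite graph\<close>

text \<open>A neighbour of \<open>(i, k)\<close> is chosen by avoiding \<open>i\<close> in one coordinate and \<open>k\<close> in the other.\<close>

lemma out_degree_crown_multipartite:
  assumes "v \<in> {1..t} \<times> {1..p}"
  shows "real (out_degree (with_proj (crown_multipartite t p)) v) = (real t - 1) * (real p - 1)"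
proof -
  obtain i k where v: "v = (i, k)" and i: "i \<in> {1..t}" and k: "k \<in> {1..p}"
    using assms by auto
  have "out_arcs (with_proj (crown_multipartite t p)) v
      = Pair v ` (({1..t} - {i}) \<times> ({1..p} - {k}))"
    using i k by (auto simp: out_arcs_def crown_multipartite_def v)
  then have "out_degree (with_proj (crown_multipartite t p)) v
      = card (({1..t} - {i}) \<times> ({1..p} - {k}))"
    unfolding out_degree_def by (simp add: card_image inj_on_def)
  also have "\<dots> = (t - 1) * (p - 1)"
    using i k by (simp add: card_cartesian_product card_Diff_singleton)
  finally show ?thesis
    using i k by (simp add: of_nat_diff)
qed

text \<open>Regularity makes the weight the same on every edge, and the adjacency condition is the
  conjunction of adjacency in the complete graphs on \<open>{1..t}\<close> and \<open>{1..p}\<close>.\<close>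

lemma weighted_adj_mat_crown_multipartite:
  assumes "set vs = {1..t} \<times> {1..p}"
  shows "weighted_adj_mat \<phi> (crown_multipartite t p) vs
    = kernel_mat (\<lambda>x y. \<phi> ((real t - 1) * (real p - 1)) ((real t - 1) * (real p - 1)) *
        kernel_tensor (\<lambda>i j. of_bool (i \<noteq> j)) (\<lambda>k l. of_bool (k \<noteq> l)) x y) vs vs"
  unfolding weighted_adj_mat_def kernel_mat_def
proof (rule cong_mat)
  fix m n
  assume "m < length vs" and "n < length vs"
  then have mn: "vs ! m \<in> {1..t} \<times> {1..p}" "vs ! n \<in> {1..t} \<times> {1..p}"
    using assms nth_mem by blast+
  then have "(vs ! m, vs ! n) \<in> parcs (crown_multipartite t p)
      \<longleftrightarrow> fst (vs ! m) \<noteq> fst (vs ! n) \<and> snd (vs ! m) \<noteq> snd (vs ! n)"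
    by (cases "vs ! m"; cases "vs ! n") (auto simp: crown_multipartite_def)
  with mn show "(case (m, n) of (i, j) \<Rightarrow> if (vs ! i, vs ! j) \<in> parcs (crown_multipartite t p)
      then \<phi> (real (out_degree (with_proj (crown_multipartite t p)) (vs ! i)))
             (real (out_degree (with_proj (crown_multipartite t p)) (vs ! j))) else 0)
    = (case (m, n) of (i, j) \<Rightarrow> \<phi> ((real t - 1) * (real p - 1)) ((real t - 1) * (real p - 1)) *
        kernel_tensor (\<lambda>i j. of_bool (i \<noteq> j)) (\<lambda>k l. of_bool (k \<noteq> l)) (vs ! i) (vs ! j))"
    by (simp add: out_degree_crown_multipartite kernel_tensor_def)
qed simp_all

text \<open>Lexicographic order extends the componentwise order of the pairs, and a tensor product of upper
  triangular kernels vanishes unless both coordinates weakly increase. Hence such a product is upper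
  triangular along this enumeration.\<close>

definition lex_pairs :: "nat \<Rightarrow> nat \<Rightarrow> (nat \<times> nat) list" where
  "lex_pairs t p = map (\<lambda>m. (Suc (m div p), Suc (m mod p))) [0..<t * p]"

lemma distinct_lex_pairs: "distinct (lex_pairs t p)"
proof -
  have "inj (\<lambda>m. (Suc (m div p), Suc (m mod p)))"
    by (rule injI) (metis Pair_inject Suc_inject div_mult_mod_eq)
  then show ?thesis
    by (auto simp: lex_pairs_def distinct_map intro: inj_on_subset)
qed

lemma set_lex_pairs: "set (lex_pairs t p) = {1..t} \<times> {1..p}"
proof (rule card_subset_eq)
  show "set (lex_pairs t p) \<subseteq> {1..t} \<times> {1..p}"
  proof (cases "p = 0")
    case False
    then show ?thesis
      by (auto simp: lex_pairs_def Suc_le_eq less_mult_imp_div_less)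
  qed (simp add: lex_pairs_def)
  show "card (set (lex_pairs t p)) = card ({1..t} \<times> {1..p})"
    using distinct_card[OF distinct_lex_pairs, of t p]
    by (simp add: lex_pairs_def card_cartesian_product)
qed simp

lemma nth_lex_pairs_mono:
  assumes "m < t * p" and "n < t * p"
    and "fst (lex_pairs t p ! m) \<le> fst (lex_pairs t p ! n)"
    and "snd (lex_pairs t p ! m) \<le> snd (lex_pairs t p ! n)"
  shows "m \<le> n"
proof -
  have "m div p * p + m mod p \<le> n div p * p + n mod p"
    using assms by (intro add_mono mult_right_mono) (simp_all add: lex_pairs_def)
  then show ?thesis
    by simp
qed

lemma complete_triangular_eq_0:
  assumes "j < i" and "1 \<le> j"
  shows "complete_triangular n i j = 0"
  using assms by (simp add: complete_triangular_def)

lemma mset_set_Times_Un: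
  assumes "finite A" "finite B" "finite C" "finite D" and "A \<inter> B = {}" "C \<inter> D = {}"
  shows "mset_set ((A \<union> B) \<times> (C \<union> D))
    = mset_set (A \<times> C) + mset_set (A \<times> D) + mset_set (B \<times> C) + mset_set (B \<times> D)"
proof -
  have "(A \<union> B) \<times> (C \<union> D) = A \<times> C \<union> A \<times> D \<union> B \<times> C \<union> B \<times> D"
    by blast
  with assms show ?thesis
    by (simp add: mset_set_Union Int_Un_distrib2 Times_Int_Times)
qed

lemma image_mset_mset_set_const:
  assumes "\<And>x. x \<in> V \<Longrightarrow> f x = a"
  shows "image_mset f (mset_set V) = replicate_mset (card V) a"
proof (cases "finite V")
  case True
  then have "image_mset f (mset_set V) = image_mset (\<lambda>_. a) (mset_set V)"
    by (intro image_mset_cong) (simp add: assms)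
  then show ?thesis
    by (simp add: image_mset_const_eq)
qed simp

text \<open>The two triangularisations are tensored. On the diagonal of the triangular form each
  factor contributes \<open>n - 1\<close> at the index \<open>1\<close> and \<open>-1\<close> elsewhere, which gives the four
  eigenvalues.\<close>

lemma Spec_crown_multipartite:
  assumes tp: "t \<ge> 1" "p \<ge> 1" and vs: "distinct vs" "set vs = {1..t} \<times> {1..p}"
    and c: "c = \<phi> ((real t - 1) * (real p - 1)) ((real t - 1) * (real p - 1))"
  shows "Spec (weighted_adj_mat \<phi> (crown_multipartite t p) vs) =
      {# (real t - 1) * (real p - 1) * c #}
      + replicate_mset (p - 1) (- ((real t - 1) * c))
      + replicate_mset (t - 1) (- ((real p - 1) * c))
      + replicate_mset ((t - 1) * (p - 1)) c"
proof -
  let ?V = "{1..t} \<times> {1..p}"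
  let ?S = "kernel_tensor ones_basis ones_basis"
  let ?R = "kernel_tensor ones_basis_inv ones_basis_inv"
  let ?U = "kernel_tensor (complete_triangular t) (complete_triangular p)"
  let ?K = "kernel_tensor (\<lambda>i j. of_bool (i \<noteq> j)) (\<lambda>k l. of_bool (k \<noteq> l))"
  let ?T = "\<lambda>x y. c * ?U x y"
  \<comment> \<open>The weight \<open>c\<close> is carried by the triangular form, so that the base changes stay pure tensors.\<close>
  have scale: "kernel_comp ?V ?S (kernel_comp ?V ?T ?R) x y
      = c * kernel_comp ?V ?S (kernel_comp ?V ?U ?R) x y" for x y
    by (simp add: kernel_comp_def sum_distrib_left mult_ac)
  have "Spec (kernel_mat (\<lambda>x y. c * ?K x y) vs vs) = image_mset (\<lambda>x. ?T x x) (mset_set ?V)"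
  proof (rule Spec_kernel_mat_triangularised[where S = ?S and R = ?R and T = ?T,
        OF vs distinct_lex_pairs set_lex_pairs])
    fix x y
    assume xy: "x \<in> ?V" "y \<in> ?V"
    show "kernel_comp ?V ?S ?R x y = of_bool (x = y)" "kernel_comp ?V ?R ?S x y = of_bool (x = y)"
      unfolding kernel_comp_tensor using xy
      by (simp_all add: kernel_tensor_def ones_basis_inverse mem_Times_iff prod_eq_iff
          of_bool_conj del: One_nat_def)
    show "c * ?K x y = kernel_comp ?V ?S (kernel_comp ?V ?T ?R) x y"
      unfolding scale kernel_comp_tensor using xy
      by (simp add: kernel_tensor_def complete_graph_triangularised mem_Times_iff del: One_nat_def)
  next
    fix m n
    assume mn: "n < m" "m < length (lex_pairs t p)"
    let ?x = "lex_pairs t p ! m" and ?y = "lex_pairs t p ! n"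
    have "?y \<in> ?V"
      using mn nth_mem[of n "lex_pairs t p"] by (simp add: set_lex_pairs)
    moreover have "fst ?y < fst ?x \<or> snd ?y < snd ?x"
      using mn nth_lex_pairs_mono[of m t p n] by (force simp: lex_pairs_def)
    ultimately show "?T ?x ?y = 0"
      by (auto simp: kernel_tensor_def complete_triangular_eq_0)
  qed
  also have "?V = ({1} \<union> {2..t}) \<times> ({1} \<union> {2..p})"
    using tp by (intro arg_cong2[where f = "(\<times>)"]) auto
  also have "mset_set \<dots> = mset_set ({1} \<times> {1}) + mset_set ({1} \<times> {2..p})
      + mset_set ({2..t} \<times> {1}) + mset_set ({2..t} \<times> {2..p})"
    by (rule mset_set_Times_Un) auto
  also have "image_mset (\<lambda>x. ?T x x) \<dots> =
      replicate_mset (card ({1::nat} \<times> {1::nat})) ((real t - 1) * (real p - 1) * c)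
      + replicate_mset (card ({1::nat} \<times> {2..p})) (- ((real t - 1) * c))
      + replicate_mset (card ({2..t} \<times> {1::nat})) (- ((real p - 1) * c))
      + replicate_mset (card ({2..t} \<times> {2..p})) c"
    unfolding image_mset_union
    by (intro arg_cong2[where f = "(+)"] image_mset_mset_set_const)
      (auto simp: kernel_tensor_def complete_triangular_def algebra_simps)
  also have "\<dots> = {# (real t - 1) * (real p - 1) * c #}
      + replicate_mset (p - 1) (- ((real t - 1) * c))
      + replicate_mset (t - 1) (- ((real p - 1) * c))
      + replicate_mset ((t - 1) * (p - 1)) c"
    by (simp add: card_cartesian_product)
  finally show ?thesis
    unfolding weighted_adj_mat_crown_multipartite[OF vs(2)] c .
qed

theorem theorem3p12:
  fixes t p :: nat and \<phi> :: "real \<Rightarrow> real \<Rightarrow> real" and d c :: real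
    and vs :: "(nat \<times> nat) list" and A :: "real mat"
  assumes "t \<ge> 2" and "p \<ge> 2"
    and phi_sym: "\<And>x y. x > 0 \<Longrightarrow> y > 0 \<Longrightarrow> \<phi> x y = \<phi> y x"
    and d: "d = (real t - 1) * (real p - 1)"
    and c: "c = \<phi> d d"
    and vs: "vertex_enumeration (crown_multipartite t p) vs"
    and A: "A = weighted_adj_mat \<phi> (crown_multipartite t p) vs"
  shows "Spec A =
      {# (real t - 1) * (real p - 1) * c #}
      + replicate_mset (p - 1) (- ((real t - 1) * c))
      + replicate_mset (t - 1) (- ((real p - 1) * c))
      + replicate_mset ((t - 1) * (p - 1)) c
    \<and> energy \<phi> (crown_multipartite t p) vs = 4 * (real t - 1) * (real p - 1) * \<bar>c\<bar>
    \<and> (c > 0 \<longrightarrow> energy \<phi> (crown_multipartite t p) vs = 4 * (real t - 1) * (real p - 1) * c)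
    \<and> (c \<noteq> 0 \<longrightarrow> invertible_mat A)
    \<and> (c > 0 \<longrightarrow> inertia A = (1 + (t - 1) * (p - 1), p + t - 2, 0))
    \<and> (c < 0 \<longrightarrow> inertia A = (p + t - 2, 1 + (t - 1) * (p - 1), 0))"
proof -
  have dist: "distinct vs" and set: "set vs = {1..t} \<times> {1..p}"
    using vs by (auto simp: vertex_enumeration_def crown_multipartite_def)
  have spec: "Spec A =
      {# (real t - 1) * (real p - 1) * c #}
      + replicate_mset (p - 1) (- ((real t - 1) * c))
      + replicate_mset (t - 1) (- ((real p - 1) * c))
      + replicate_mset ((t - 1) * (p - 1)) c"
    unfolding A using assms(1,2) dist set by (intro Spec_crown_multipartite) (simp_all add: c d)
  have pos: "real t - 1 > 0" "real p - 1 > 0"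
    using assms(1,2) by simp_all
  have energy: "energy \<phi> (crown_multipartite t p) vs = 4 * (real t - 1) * (real p - 1) * \<bar>c\<bar>"
  proof -
    have abs_eigenvalues:
      "\<bar>(real t - 1) * (real p - 1) * c\<bar> = (real t - 1) * (real p - 1) * \<bar>c\<bar>"
      "\<bar>- ((real t - 1) * c)\<bar> = (real t - 1) * \<bar>c\<bar>"
      "\<bar>- ((real p - 1) * c)\<bar> = (real p - 1) * \<bar>c\<bar>"
      using pos by (simp_all add: abs_mult)
    have multiplicities: "real (t - 1) = real t - 1" "real (p - 1) = real p - 1"
      using assms(1,2) by (simp_all add: of_nat_diff)
    have "energy \<phi> (crown_multipartite t p) vs = \<bar>(real t - 1) * (real p - 1) * c\<bar>
        + real (p - 1) * \<bar>- ((real t - 1) * c)\<bar> + real (t - 1) * \<bar>- ((real p - 1) * c)\<bar>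
        + real (t - 1) * real (p - 1) * \<bar>c\<bar>"
      unfolding energy_def A[symmetric] spec
      by (simp only: image_mset_union image_mset_add_mset image_mset_empty image_replicate_mset
          sum_mset.union sum_mset.add_mset sum_mset.empty sum_mset_replicate_mset of_nat_mult)
    then show ?thesis
      unfolding abs_eigenvalues multiplicities by (simp add: algebra_simps)
  qed
  have inv: "invertible_mat A" if "c \<noteq> 0"
  proof (rule invertible_mat_if_zero_notin_Spec)
    show "A \<in> carrier_mat (length vs) (length vs)"
      by (simp add: A weighted_adj_mat_def)
    show "0 \<notin># Spec A"
      unfolding spec using pos that by auto
  qed
  have filter_replicate: "filter_mset P (replicate_mset n a) = (if P a then replicate_mset n a else {#})"
    for P n and a :: real
    by (induction n) auto
  have in_pos: "inertia A = (1 + (t - 1) * (p - 1), p + t - 2, 0)" if "c > 0"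
    unfolding inertia_def spec using pos that assms(1,2)
    by (simp add: filter_replicate zero_less_mult_iff mult_less_0_iff)
  have in_neg: "inertia A = (p + t - 2, 1 + (t - 1) * (p - 1), 0)" if "c < 0"
    unfolding inertia_def spec using pos that assms(1,2)
    by (simp add: filter_replicate zero_less_mult_iff mult_less_0_iff)
  show ?thesis
    using spec energy inv in_pos in_neg by simp
qed

end
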